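(* Let $M,N\in\mathbb{N}$ and let $g\in\ell^2(\mathbb{Z})$ be finitely supported. If the Gabor system $\{E_{m/M}T_{nN}g\}_{n\in\mathbb{Z},\,m=0,\dots,M-1}$ is an overcomplete frame for $\ell^2(\mathbb{Z})$, then it is linearly dependent.
   Context: $\mathbb{N}=\{1,2,3,\dots\}$. $\ell^2(\mathbb{Z})$ is the complex Hilbert space of square-summable sequences indexed by $\mathbb{Z}$; $g(j)$ denotes the $j$th coordinate of $g\in\ell^2(\mathbb{Z})$. For $M,N\in\mathbb{N}$, $m\in\{0,\dots,M-1\}$ and $n\in\mathbb{Z}$, the modulation operator is $E_{m/M}g(j)=e^{2\pi i jm/M}g(j)$ and the translation operator is $T_n g(j)=g(j-n)$, so $E_{m/M}T_{nN}g(j)=e^{2\pi i jm/M}g(j-nN)$. A countable family $\{f_k\}$ in a Hilbert space $H$ is a frame for $H$ if there are constants $A,B>0$ with $A\|f\|^2\le\sum_k|\langle f,f_k\rangle|^2\le B\|f\|^2$ for all $f\in H$. A frame is overcomplete if it is not a basis (for frames, being a Schauder basis is equivalent to being a Riesz basis). Linear dependence refers to the indexed family over $(n,m)\in\mathbb{Z}\times\{0,\dots,M-1\}$ (repeated vectors count as dependent) and to finite complex linear combinations: the family is linearly dependent if some finite linear combination with not all coefficients zero equals $0$. *)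

theory Defs
  imports "HOL-Analysis.Analysis"
begin

text \<open>
  The complex Hilbert space \<open>\<ell>\<^sup>2(\<int>)\<close> is rendered as a set of functions on the integers.
  The values of \<open>ell2_inner\<close> and \<open>ell2_norm\<close> are meaningful only for arguments in \<open>ell2\<close>,
  because \<open>infsum\<close> is 0 on families that are not summable.
\<close>

definition ell2 :: "(int \<Rightarrow> complex) set" where
  "ell2 = {f. (\<lambda>j. (cmod (f j))\<^sup>2) summable_on UNIV}"

definition ell2_inner :: "(int \<Rightarrow> complex) \<Rightarrow> (int \<Rightarrow> complex) \<Rightarrow> complex" where
  "ell2_inner f g = (\<Sum>\<^sub>\<infinity>j. f j * cnj (g j))"

definition ell2_norm :: "(int \<Rightarrow> complex) \<Rightarrow> real" where
  "ell2_norm f = sqrt (\<Sum>\<^sub>\<infinity>j. (cmod (f j))\<^sup>2)"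

definition modulation :: "real \<Rightarrow> (int \<Rightarrow> complex) \<Rightarrow> int \<Rightarrow> complex" where
  "modulation b g = (\<lambda>j. exp (2 * of_real pi * \<i> * of_int j * of_real b) * g j)"

definition translation :: "int \<Rightarrow> (int \<Rightarrow> complex) \<Rightarrow> int \<Rightarrow> complex" where
  "translation n g = (\<lambda>j. g (j - n))"

definition gabor_index :: "nat \<Rightarrow> (int \<times> nat) set" where
  "gabor_index M = UNIV \<times> {0..<M}"

definition gabor_system ::
    "nat \<Rightarrow> nat \<Rightarrow> (int \<Rightarrow> complex) \<Rightarrow> int \<times> nat \<Rightarrow> int \<Rightarrow> complex" where
  "gabor_system M N g =
     (\<lambda>(n, m). modulation (real m / real M) (translation (n * int N) g))"

definition ell2_frame :: "'k set \<Rightarrow> ('k \<Rightarrow> int \<Rightarrow> complex) \<Rightarrow> bool" where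
  "ell2_frame I f \<longleftrightarrow>
     countable I \<and> (\<forall>k\<in>I. f k \<in> ell2) \<and>
     (\<exists>A>0. \<exists>B>0. \<forall>h\<in>ell2.
        (\<lambda>k. (cmod (ell2_inner h (f k)))\<^sup>2) summable_on I \<and>
        A * (ell2_norm h)\<^sup>2 \<le> (\<Sum>\<^sub>\<infinity>k\<in>I. (cmod (ell2_inner h (f k)))\<^sup>2) \<and>
        (\<Sum>\<^sub>\<infinity>k\<in>I. (cmod (ell2_inner h (f k)))\<^sup>2) \<le> B * (ell2_norm h)\<^sup>2)"

definition ell2_schauder_basis :: "(nat \<Rightarrow> int \<Rightarrow> complex) \<Rightarrow> bool" where
  "ell2_schauder_basis x \<longleftrightarrow>
     (\<forall>k. x k \<in> ell2) \<and>
     (\<forall>h\<in>ell2. \<exists>!c :: nat \<Rightarrow> complex.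
        (\<lambda>n. ell2_norm (\<lambda>j. h j - (\<Sum>k<n. c k * x k j))) \<longlonglongrightarrow> 0)"

text \<open>
  The index set of a family carries no preferred order, so a family is called a basis if it is a
  Schauder basis in some enumeration without repetition of its indices. For a frame the choice of
  enumeration is immaterial: a frame that is a Schauder basis is a Riesz basis, hence an
  unconditional basis. A finite family is never a basis of the infinite-dimensional space.
\<close>

definition ell2_basis :: "'k set \<Rightarrow> ('k \<Rightarrow> int \<Rightarrow> complex) \<Rightarrow> bool" where
  "ell2_basis I f \<longleftrightarrow>
     (\<exists>e :: nat \<Rightarrow> 'k. bij_betw e UNIV I \<and> ell2_schauder_basis (\<lambda>k. f (e k)))"

definition overcomplete_frame :: "'k set \<Rightarrow> ('k \<Rightarrow> int \<Rightarrow> complex) \<Rightarrow> bool" where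
  "overcomplete_frame I f \<longleftrightarrow> ell2_frame I f \<and> \<not> ell2_basis I f"

text \<open>
  Dependence of the indexed family, so that repeated vectors are dependent; the library notion
  \<open>dependent\<close> concerns sets of vectors instead.
\<close>

definition linearly_dependent_family :: "'k set \<Rightarrow> ('k \<Rightarrow> int \<Rightarrow> complex) \<Rightarrow> bool" where
  "linearly_dependent_family I f \<longleftrightarrow>
     (\<exists>F c. finite F \<and> F \<subseteq> I \<and> (\<exists>k\<in>F. c k \<noteq> 0) \<and>
        (\<forall>j. (\<Sum>k\<in>F. c k * f k j) = 0))"

end

theory Submission
  imports Defs
begin

text \<open>
  If \<open>N < M\<close>, a long block of atoms consists of more vectors than the number of coordinates on
  which they live, so it is dependent. If \<open>M < N\<close>, the same count yields a nonzero finitely supported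
  sequence orthogonal to all atoms, contradicting the lower frame bound. If \<open>M = N\<close>, a discrete
  Fourier transform in the modulation index splits the system into integer translates of a finitely
  supported sequence on each residue class mod \<open>M\<close>. Synthesis is then a convolution, hence normal,
  so the frame bounds are also Riesz bounds; together with surjectivity of synthesis, the frame is
  a basis and hence not overcomplete.
\<close>

section \<open>Square-summable sequences\<close>

text \<open>A lower frame bound is a lower bound for analysis, the adjoint of synthesis; by itself
  it yields only that synthesis is onto. That synthesis is also bounded below has to come from
  commutativity. When \<open>M = N\<close>, the period of the characters equals the translation
  step, so modulations commute with translations and synthesis factors as
  \<open>fiber_synthesis M g\<close> after \<open>block_dft M\<close>. The second operator is
  \<open>sqrt M\<close> times a unitary; the first agrees with its own adjoint up to isometries.
  Gabor indices \<open>(n, m)\<close> are encoded as the integers \<open>n * M + m\<close>, so that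
  coefficients and signals are both functions on the integers. Since \<open>g\<close> is finitely
  supported, each output coordinate of the operators involved depends on finitely many input
  coordinates; sums and series can therefore be moved through them coordinatewise, before any
  convergence in norm is discussed.\<close>

lemma ell2_norm_square: "(ell2_norm f)\<^sup>2 = (\<Sum>\<^sub>\<infinity>j. (cmod (f j))\<^sup>2)"
  unfolding ell2_norm_def by (simp add: infsum_nonneg)

lemma ell2_norm_nonneg: "0 \<le> ell2_norm f"
  unfolding ell2_norm_def by (simp add: infsum_nonneg)

lemma ell2_has_sum:
  "f \<in> ell2 \<Longrightarrow> ((\<lambda>j. (cmod (f j))\<^sup>2) has_sum (ell2_norm f)\<^sup>2) UNIV"
  unfolding ell2_norm_square ell2_def by simp

lemma has_sum_imp_ell2:
  assumes "((\<lambda>j. (cmod (f j))\<^sup>2) has_sum s) UNIV"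
  shows "f \<in> ell2" and "(ell2_norm f)\<^sup>2 = s"
  using assms unfolding ell2_norm_square ell2_def
  by (auto simp: infsumI summable_on_def)

lemma ell2_finite_sum_le:
  assumes "f \<in> ell2" and "finite F"
  shows "(\<Sum>j\<in>F. (cmod (f j))\<^sup>2) \<le> (ell2_norm f)\<^sup>2"
  by (rule finite_sum_le_has_sum[OF ell2_has_sum]) (use assms in auto)

lemma ell2_cmod_le: "f \<in> ell2 \<Longrightarrow> cmod (f j) \<le> ell2_norm f"
  using ell2_finite_sum_le[of f "{j}"] by (auto intro: power2_le_imp_le ell2_norm_nonneg)

lemma ell2_bounded_finite_sums:
  assumes "\<And>F. finite F \<Longrightarrow> (\<Sum>j\<in>F. (cmod (f j))\<^sup>2) \<le> C"
  shows "f \<in> ell2"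
  unfolding ell2_def mem_Collect_eq
  by (rule nonneg_bdd_above_summable_on) (auto intro!: bdd_aboveI[of _ C] assms)

lemma ell2_comparison:
  assumes "f \<in> ell2" and "\<And>j. (cmod (h j))\<^sup>2 \<le> C * (cmod (f j))\<^sup>2"
  shows "h \<in> ell2"
  using assms unfolding ell2_def
  by (auto intro!: summable_on_comparison_test[where f = "\<lambda>j. C * (cmod (f j))\<^sup>2"]
      summable_on_cmult_right)

lemma ell2_mult_bounded:
  assumes "f \<in> ell2" and "\<And>j. cmod (b j) \<le> C"
  shows "(\<lambda>j. b j * f j) \<in> ell2"
  by (rule ell2_comparison[OF assms(1), of _ "C\<^sup>2"])
    (auto simp: norm_mult power_mult_distrib intro!: mult_right_mono power_mono assms(2))

lemma ell2_zero: "(\<lambda>_. 0) \<in> ell2"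
  unfolding ell2_def by simp

lemma ell2_cmult: "f \<in> ell2 \<Longrightarrow> (\<lambda>j. a * f j) \<in> ell2"
  by (rule ell2_mult_bounded[where C = "cmod a"]) auto

lemma ell2_add:
  assumes "f \<in> ell2" and "h \<in> ell2"
  shows "(\<lambda>j. f j + h j) \<in> ell2"
proof -
  have "(cmod (a + b))\<^sup>2 \<le> 2 * (cmod a)\<^sup>2 + 2 * (cmod b)\<^sup>2" for a b
  proof -
    have "(cmod (a + b))\<^sup>2 \<le> (cmod a + cmod b)\<^sup>2"
      by (intro power_mono norm_triangle_ineq) auto
    also have "\<dots> \<le> 2 * (cmod a)\<^sup>2 + 2 * (cmod b)\<^sup>2"
      using sum_squares_ge_zero[of "cmod a - cmod b" 0]
      by (simp add: power2_eq_square algebra_simps)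
    finally show ?thesis .
  qed
  then show ?thesis
    using assms unfolding ell2_def
    by (auto intro!: summable_on_add summable_on_cmult_right summable_on_comparison_test
        [where f = "\<lambda>j. 2 * (cmod (f j))\<^sup>2 + 2 * (cmod (h j))\<^sup>2"])
qed

lemma ell2_diff: "f \<in> ell2 \<Longrightarrow> h \<in> ell2 \<Longrightarrow> (\<lambda>j. f j - h j) \<in> ell2"
  using ell2_add[of f "\<lambda>j. (-1) * h j"] ell2_cmult[of h "-1"] by simp

lemma ell2_sum:
  "finite S \<Longrightarrow> (\<And>t. t \<in> S \<Longrightarrow> f t \<in> ell2) \<Longrightarrow> (\<lambda>j. \<Sum>t\<in>S. f t j) \<in> ell2"
  by (induction S rule: finite_induct) (auto simp: ell2_zero intro: ell2_add)

lemma ell2_reindex: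
  assumes "bij \<pi>"
  shows "(\<lambda>j. f (\<pi> j)) \<in> ell2 \<longleftrightarrow> f \<in> ell2"
    and "ell2_norm (\<lambda>j. f (\<pi> j)) = ell2_norm f"
  using summable_on_reindex_bij_betw[OF assms, of "\<lambda>j. (cmod (f j))\<^sup>2"]
    infsum_reindex_bij_betw[OF assms, of "\<lambda>j. (cmod (f j))\<^sup>2"]
  unfolding ell2_def ell2_norm_def by auto

lemma ell2_finite_support:
  assumes "finite {j. f j \<noteq> 0}"
  shows "f \<in> ell2"
  unfolding ell2_def mem_Collect_eq
  by (rule finite_nonzero_values_imp_summable_on) (use assms in simp)

section \<open>Inner products and completeness\<close>

lemma ell2_inner_summable:
  assumes "f \<in> ell2" and "h \<in> ell2"
  shows "(\<lambda>j. f j * cnj (h j)) summable_on UNIV"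
proof (rule abs_summable_summable,
    rule summable_on_comparison_test[where f = "\<lambda>j. (cmod (f j))\<^sup>2 + (cmod (h j))\<^sup>2"])
  show "(\<lambda>j. (cmod (f j))\<^sup>2 + (cmod (h j))\<^sup>2) summable_on UNIV"
    using assms unfolding ell2_def by (auto intro: summable_on_add)
  fix j
  have "2 * (cmod (f j) * cmod (h j)) \<le> (cmod (f j))\<^sup>2 + (cmod (h j))\<^sup>2"
    using sum_squares_bound[of "cmod (f j)" "cmod (h j)"] by (simp add: algebra_simps)
  moreover have "0 \<le> cmod (f j) * cmod (h j)"
    by simp
  ultimately show "norm (f j * cnj (h j)) \<le> (cmod (f j))\<^sup>2 + (cmod (h j))\<^sup>2"
    unfolding norm_mult complex_mod_cnj by linarith
qed auto

lemma ell2_inner_has_sum: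
  "f \<in> ell2 \<Longrightarrow> h \<in> ell2 \<Longrightarrow> ((\<lambda>j. f j * cnj (h j)) has_sum ell2_inner f h) UNIV"
  unfolding ell2_inner_def by (simp add: ell2_inner_summable)

lemma ell2_inner_self: "f \<in> ell2 \<Longrightarrow> Re (ell2_inner f f) = (ell2_norm f)\<^sup>2"
  using has_sum_Re[OF ell2_inner_has_sum[of f f]] ell2_has_sum[of f]
  by (auto simp: complex_mult_cnj cmod_power2 intro: has_sum_unique)

text \<open>Supplies the contraction estimate of the Neumann iteration, with
  \<open>t = 1 / B\<close> and \<open>s = L (L' r)\<close>.\<close>

lemma ell2_norm_diff_square:
  assumes "r \<in> ell2" and "s \<in> ell2"
  shows "(ell2_norm (\<lambda>j. r j - of_real t * s j))\<^sup>2
    = (ell2_norm r)\<^sup>2 - 2 * t * Re (ell2_inner s r) + t\<^sup>2 * (ell2_norm s)\<^sup>2"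
proof (rule has_sum_imp_ell2(2))
  have eq: "(cmod (r j - of_real t * s j))\<^sup>2
      = (cmod (r j))\<^sup>2 + (- 2 * t) * Re (s j * cnj (r j)) + t\<^sup>2 * (cmod (s j))\<^sup>2" for j
    unfolding cmod_power2 by (simp add: power2_eq_square algebra_simps)
  have "((\<lambda>j. (cmod (r j - of_real t * s j))\<^sup>2) has_sum
      ((ell2_norm r)\<^sup>2 + (- 2 * t) * Re (ell2_inner s r) + t\<^sup>2 * (ell2_norm s)\<^sup>2)) UNIV"
    unfolding eq
    by (intro has_sum_add has_sum_cmult_right ell2_has_sum has_sum_Re ell2_inner_has_sum assms)
  then show "((\<lambda>j. (cmod (r j - of_real t * s j))\<^sup>2) has_sum
      ((ell2_norm r)\<^sup>2 - 2 * t * Re (ell2_inner s r) + t\<^sup>2 * (ell2_norm s)\<^sup>2)) UNIV"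
    by simp
qed

lemma L2_set_sum_le:
  fixes n :: nat and f :: "nat \<Rightarrow> 'a \<Rightarrow> complex"
  assumes "finite F"
  shows "L2_set (\<lambda>j. cmod (\<Sum>i<n. f i j)) F \<le> (\<Sum>i<n. L2_set (\<lambda>j. cmod (f i j)) F)"
proof (induction n)
  case 0
  then show ?case by (simp add: L2_set_def)
next
  case (Suc n)
  have "L2_set (\<lambda>j. cmod (\<Sum>i<Suc n. f i j)) F
      \<le> L2_set (\<lambda>j. cmod (\<Sum>i<n. f i j) + cmod (f n j)) F"
    by (intro L2_set_mono) (auto simp: norm_triangle_ineq)
  also have "\<dots> \<le> L2_set (\<lambda>j. cmod (\<Sum>i<n. f i j)) F + L2_set (\<lambda>j. cmod (f n j)) F"
    by (rule L2_set_triangle_ineq)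
  finally show ?case using Suc by simp
qed

text \<open>Completeness in the form used for Neumann series. Coordinates are dominated by norms, so
  the series converges pointwise; Minkowski's inequality bounds the partial sums on every finite set
  \<open>F\<close> by \<open>C\<close>, and this bound survives the limit.\<close>

lemma ell2_suminf:
  assumes f: "\<And>i. f i \<in> ell2" and "summable (\<lambda>i. ell2_norm (f i))"
  shows "summable (\<lambda>i. f i j)" and "(\<lambda>j. \<Sum>i. f i j) \<in> ell2"
proof -
  show summ: "summable (\<lambda>i. f i j)" for j
    by (rule summable_comparison_test[OF _ assms(2)]) (auto intro: ell2_cmod_le f)
  define C where "C = (\<Sum>i. ell2_norm (f i))"
  have "(\<Sum>j\<in>F. (cmod (\<Sum>i. f i j))\<^sup>2) \<le> C\<^sup>2" if "finite F" for F
  proof (rule LIMSEQ_le_const2)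
    show "(\<lambda>n. \<Sum>j\<in>F. (cmod (\<Sum>i<n. f i j))\<^sup>2) \<longlonglongrightarrow> (\<Sum>j\<in>F. (cmod (\<Sum>i. f i j))\<^sup>2)"
      by (intro tendsto_intros summable_LIMSEQ summ)
    have "(\<Sum>j\<in>F. (cmod (\<Sum>i<n. f i j))\<^sup>2) \<le> C\<^sup>2" for n
    proof -
      have "L2_set (\<lambda>j. cmod (\<Sum>i<n. f i j)) F \<le> (\<Sum>i<n. L2_set (\<lambda>j. cmod (f i j)) F)"
        by (rule L2_set_sum_le[OF that])
      also have "\<dots> \<le> (\<Sum>i<n. ell2_norm (f i))"
        unfolding L2_set_def
        by (intro sum_mono real_le_lsqrt ell2_norm_nonneg ell2_finite_sum_le f that)
      also have "\<dots> \<le> C"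
        unfolding C_def by (intro sum_le_suminf assms(2)) (auto simp: ell2_norm_nonneg)
      finally have "(L2_set (\<lambda>j. cmod (\<Sum>i<n. f i j)) F)\<^sup>2 \<le> C\<^sup>2"
        by (intro power_mono) auto
      then show ?thesis
        by (simp add: L2_set_def sum_nonneg)
    qed
    then show "\<exists>N. \<forall>n\<ge>N. (\<Sum>j\<in>F. (cmod (\<Sum>i<n. f i j))\<^sup>2) \<le> C\<^sup>2"
      by blast
  qed
  then show "(\<lambda>j. \<Sum>i. f i j) \<in> ell2"
    by (rule ell2_bounded_finite_sums)
qed

section \<open>Row-finite operators\<close>

text \<open>The matrix of \<open>L\<close> has finitely many nonzero entries in each row. This
  encodes linearity together with continuity under pointwise convergence, on all functions on the
  integers.\<close>

definition row_finite :: "((int \<Rightarrow> complex) \<Rightarrow> int \<Rightarrow> complex) \<Rightarrow> bool" where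
  "row_finite L \<longleftrightarrow>
     (\<forall>j. \<exists>S w. finite S \<and> (\<forall>u. L u j = (\<Sum>i\<in>S. w i * u i)))"

lemma row_finiteE:
  assumes "row_finite L"
  obtains S w where "finite S" and "\<And>u. L u j = (\<Sum>i\<in>S. w i * u i)"
  using assms unfolding row_finite_def by meson

lemma row_finiteI:
  assumes "finite T" and inj: "\<And>j. inj_on (\<sigma> j) T"
  shows "row_finite (\<lambda>u j. \<Sum>t\<in>T. b j t * u (\<sigma> j t))"
  unfolding row_finite_def
proof
  fix j
  have "(\<Sum>t\<in>T. b j t * u (\<sigma> j t)) = (\<Sum>i\<in>\<sigma> j ` T. b j (inv_into T (\<sigma> j) i) * u i)" for u
    using inj by (simp add: sum.reindex)
  then show "\<exists>S w. finite S \<and> (\<forall>u. (\<Sum>t\<in>T. b j t * u (\<sigma> j t)) = (\<Sum>i\<in>S. w i * u i))"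
    using assms(1)
    by (intro exI[of _ "\<sigma> j ` T"] exI[of _ "\<lambda>i. b j (inv_into T (\<sigma> j) i)"]) simp
qed

lemma row_finite_cmult: "row_finite L \<Longrightarrow> L (\<lambda>i. a * u i) j = a * L u j"
  by (elim row_finiteE[where j = j]) (simp add: algebra_simps sum_distrib_left)

lemma row_finite_diff:
  "row_finite L \<Longrightarrow> L (\<lambda>i. u i - v i) j = L u j - L v j"
  by (elim row_finiteE[where j = j]) (simp add: algebra_simps sum_subtractf)

lemma row_finite_sum:
  assumes "row_finite L" and "finite K"
  shows "L (\<lambda>i. \<Sum>k\<in>K. u k i) j = (\<Sum>k\<in>K. L (u k) j)"
proof -
  obtain S w where S: "finite S" "\<And>u. L u j = (\<Sum>i\<in>S. w i * u i)"
    using row_finiteE[OF assms(1)] by metis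
  show ?thesis
    unfolding S(2) sum_distrib_left by (rule sum.swap)
qed

lemma row_finite_suminf:
  assumes "row_finite L" and "\<And>i. summable (\<lambda>n. u n i)"
  shows "L (\<lambda>i. \<Sum>n. u n i) j = (\<Sum>n. L (u n) j)"
proof -
  obtain S w where S: "finite S" "\<And>u. L u j = (\<Sum>i\<in>S. w i * u i)"
    using row_finiteE[OF assms(1)] by metis
  show ?thesis
    unfolding S(2) using assms(2) by (simp add: suminf_sum suminf_mult summable_mult)
qed

lemma row_finite_compose:
  assumes "row_finite L" and "row_finite L'"
  shows "row_finite (\<lambda>u. L (L' u))"
  unfolding row_finite_def
proof
  fix j
  obtain S w where S: "finite S" "\<And>u. L u j = (\<Sum>i\<in>S. w i * u i)"
    using row_finiteE[OF assms(1)] by metis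
  have "\<forall>i. \<exists>R. \<exists>x. finite R \<and> (\<forall>u. L' u i = (\<Sum>l\<in>R. x l * u l))"
    using assms(2) unfolding row_finite_def .
  then obtain R x where R: "\<And>i. finite (R i)" "\<And>i u. L' u i = (\<Sum>l\<in>R i. x i l * u l)"
    by metis
  \<comment> \<open>All columns occurring in the rows of \<open>L'\<close> that row \<open>j\<close>
    of \<open>L\<close> uses. Padding these rows with zeros makes the double sum rectangular, so
    that it can be swapped.\<close>
  define Q where "Q = (\<Union>i\<in>S. R i)"
  have Q: "finite Q"
    unfolding Q_def using S(1) R(1) by blast
  define y where "y l = (\<Sum>i\<in>S. w i * (if l \<in> R i then x i l else 0))" for l
  have "L (L' u) j = (\<Sum>l\<in>Q. y l * u l)" for u
  proof -
    have "L' u i = (\<Sum>l\<in>Q. (if l \<in> R i then x i l else 0) * u l)" if "i \<in> S" for i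
      unfolding R(2) using that
      by (intro sum.mono_neutral_cong_left Q) (auto simp: Q_def)
    then have "L (L' u) j = (\<Sum>i\<in>S. \<Sum>l\<in>Q. w i * (if l \<in> R i then x i l else 0) * u l)"
      unfolding S(2) by (auto simp: sum_distrib_left mult.assoc intro!: sum.cong)
    also have "\<dots> = (\<Sum>l\<in>Q. y l * u l)"
      unfolding y_def sum_distrib_right by (rule sum.swap)
    finally show ?thesis .
  qed
  with Q show "\<exists>S w. finite S \<and> (\<forall>u. L (L' u) j = (\<Sum>i\<in>S. w i * u i))"
    by blast
qed

text \<open>
  The witness is \<open>L' x\<close>, where \<open>x\<close> solves \<open>L (L' x) = h\<close> and is given by the Neumann series for
  \<open>L L'\<close>: since \<open>A \<le> L L' \<le> B\<close>, the operator \<open>1 - B\<inverse> L L'\<close> is a contraction.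
\<close>

lemma surj_of_adjoint_bounded_below:
  assumes rf: "row_finite L" "row_finite L'"
    and L: "\<And>u. u \<in> ell2 \<Longrightarrow> L u \<in> ell2"
      "\<And>u. u \<in> ell2 \<Longrightarrow> (ell2_norm (L u))\<^sup>2 \<le> B * (ell2_norm u)\<^sup>2"
    and L': "\<And>u. u \<in> ell2 \<Longrightarrow> L' u \<in> ell2"
      "\<And>u. u \<in> ell2 \<Longrightarrow> A * (ell2_norm u)\<^sup>2 \<le> (ell2_norm (L' u))\<^sup>2"
    and adj: "\<And>u v. u \<in> ell2 \<Longrightarrow> v \<in> ell2 \<Longrightarrow> ell2_inner (L u) v = ell2_inner u (L' v)"
    and pos: "A > 0" "B > 0"
    and h: "h \<in> ell2"
  shows "\<exists>u\<in>ell2. L u = h"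
proof -
  \<comment> \<open>\<open>r i\<close> is \<open>(1 - L L' / B)^i h\<close>, the \<open>i\<close>-th
    term of the Neumann series up to the factor \<open>1 / B\<close>.\<close>
  define r where
    "r = rec_nat h (\<lambda>_ r j. r j - of_real (1 / B) * L (L' r) j)"
  have r_0: "r 0 = h" and r_Suc: "r (Suc i) = (\<lambda>j. r i j - of_real (1 / B) * L (L' (r i)) j)" for i
    unfolding r_def by simp_all
  have r: "r i \<in> ell2" for i
    by (induction i) (auto simp: r_0 r_Suc h simp del: of_real_divide
        intro!: ell2_diff ell2_cmult L(1) L'(1))
  \<comment> \<open>The maximum with 0 keeps the ratio nonnegative without a comparison of
    \<open>A\<close> and \<open>B\<close>.\<close>
  define q where "q = max 0 (1 - A / B)"
  have q: "0 \<le> q" "q < 1"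
    unfolding q_def using pos by auto
  have "(ell2_norm (r (Suc i)))\<^sup>2 \<le> q * (ell2_norm (r i))\<^sup>2" for i
  proof -
    define a where "a = (ell2_norm (L' (r i)))\<^sup>2"
    have "Re (ell2_inner (L (L' (r i))) (r i)) = a"
      by (simp add: a_def adj L' r ell2_inner_self)
    then have "(ell2_norm (r (Suc i)))\<^sup>2
        = (ell2_norm (r i))\<^sup>2 - 2 * (1 / B) * a + (1 / B)\<^sup>2 * (ell2_norm (L (L' (r i))))\<^sup>2"
      using ell2_norm_diff_square[OF r L(1)[OF L'(1)[OF r]], of i "1 / B" i]
      unfolding r_Suc by simp
    \<comment> \<open>The upper bound for \<open>L\<close> is applied to \<open>L' (r i)\<close>,
      whose squared norm is \<open>a\<close>; of the gain \<open>2 * a / B\<close> one copy of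
      \<open>a / B\<close> remains.\<close>
    also have "\<dots> \<le> (ell2_norm (r i))\<^sup>2 - 2 * (1 / B) * a + (1 / B)\<^sup>2 * (B * a)"
      unfolding a_def by (intro add_left_mono mult_left_mono L L' r) auto
    also have "\<dots> = (ell2_norm (r i))\<^sup>2 - a / B"
      using pos by (simp add: field_simps power2_eq_square)
    also have "\<dots> \<le> (ell2_norm (r i))\<^sup>2 - A * (ell2_norm (r i))\<^sup>2 / B"
      unfolding a_def using pos by (intro diff_left_mono divide_right_mono L' r) auto
    also have "\<dots> = (1 - A / B) * (ell2_norm (r i))\<^sup>2"
      by (simp add: field_simps)
    also have "\<dots> \<le> q * (ell2_norm (r i))\<^sup>2"
      unfolding q_def by (intro mult_right_mono) auto
    finally show ?thesis .
  qed
  then have step: "ell2_norm (r (Suc i)) \<le> sqrt q * ell2_norm (r i)" for i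
    using real_sqrt_le_mono by (fastforce simp: real_sqrt_mult ell2_norm_nonneg)
  have bound: "ell2_norm (r i) \<le> sqrt q ^ i * ell2_norm h" for i
  proof (induction i)
    case 0
    show ?case by (simp add: r_0)
  next
    case (Suc i)
    have "ell2_norm (r (Suc i)) \<le> sqrt q * (sqrt q ^ i * ell2_norm h)"
      using step[of i] mult_left_mono[OF Suc, of "sqrt q"] q by simp
    then show ?case by (simp add: mult.assoc)
  qed
  have "summable (\<lambda>i. sqrt q ^ i * ell2_norm h)"
    using q by (intro summable_mult2 summable_geometric) auto
  then have summ: "summable (\<lambda>i. ell2_norm (r i))"
    by (rule summable_comparison_test[rotated]) (use bound in \<open>auto simp: ell2_norm_nonneg\<close>)
  define x where "x = (\<lambda>j. of_real (1 / B) * (\<Sum>i. r i j))"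
  have x: "x \<in> ell2"
    unfolding x_def by (intro ell2_cmult ell2_suminf(2) r summ)
  have "L (L' x) j = h j" for j
  proof -
    have rfc: "row_finite (\<lambda>u. L (L' u))"
      by (rule row_finite_compose[OF rf])
    have lim: "(\<lambda>i. r i j) \<longlonglongrightarrow> 0"
      by (intro summable_LIMSEQ_zero ell2_suminf(1) r summ)
    have "L (L' x) j = of_real (1 / B) * (\<Sum>i. L (L' (r i)) j)"
      unfolding x_def row_finite_cmult[OF rfc]
      by (subst row_finite_suminf[OF rfc]) (auto intro: ell2_suminf(1) r summ)
    \<comment> \<open>By the recursion, \<open>L (L' (r i))\<close> is \<open>B\<close> times the
      difference of consecutive terms, so the series telescopes to \<open>B * h j\<close>.\<close>
    moreover have "(\<lambda>i. of_real B * (r i j - r (Suc i) j)) sums (of_real B * (r 0 j - 0))"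
      by (intro sums_mult telescope_sums' lim)
    moreover have "of_real B * (r i j - r (Suc i) j) = L (L' (r i)) j" for i
      unfolding r_Suc using pos by simp
    ultimately show ?thesis
      using pos by (simp add: r_0 sums_iff)
  qed
  then show ?thesis
    using L'(1)[OF x] by blast
qed


text \<open>The coefficients of \<open>h = L u\<close> are the coordinates of \<open>u\<close>, in
  any enumeration. The upper bound carries the convergence of truncations from \<open>u\<close> to
  \<open>h\<close>; the lower bound forces uniqueness.\<close>

lemma schauder_basis_of_isomorphism:
  assumes rf: "row_finite L"
    and L: "\<And>u. u \<in> ell2 \<Longrightarrow> L u \<in> ell2"
      "\<And>u. u \<in> ell2 \<Longrightarrow> (ell2_norm (L u))\<^sup>2 \<le> B * (ell2_norm u)\<^sup>2"
      "\<And>u. u \<in> ell2 \<Longrightarrow> A * (ell2_norm u)\<^sup>2 \<le> (ell2_norm (L u))\<^sup>2"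
    and surj: "\<And>h. h \<in> ell2 \<Longrightarrow> \<exists>u\<in>ell2. L u = h"
    and A: "A > 0"
    and e: "bij e"
  shows "ell2_schauder_basis (\<lambda>k. L (\<lambda>i. if i = e k then 1 else 0))"
  unfolding ell2_schauder_basis_def
proof (intro conjI allI ballI)
  show "L (\<lambda>i. if i = e k then 1 else 0) \<in> ell2" for k
    by (intro L(1) ell2_finite_support) simp
next
  fix h assume h: "h \<in> ell2"
  then obtain u where u: "u \<in> ell2" and Lu: "L u = h"
    using surj by blast
  define s where "s c n i = (\<Sum>k<n. c k * (if i = e k then 1 else 0))" for c :: "nat \<Rightarrow> complex" and n i
  have s_e: "s c n (e k) = (if k < n then c k else 0)" for c n k
    unfolding s_def using bij_is_inj[OF e]
    by (auto simp: inj_eq if_distrib cong: if_cong)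
  have s_ell2: "s c n \<in> ell2" for c n
  proof (rule ell2_finite_support, rule finite_subset)
    show "{i. s c n i \<noteq> 0} \<subseteq> e ` {..<n}"
      unfolding s_def by (force intro!: sum.neutral)
  qed simp
  \<comment> \<open>Stated for arbitrary \<open>c\<close>, since uniqueness concerns the residuals
    of unknown expansions.\<close>
  have partial: "(\<lambda>j. h j - (\<Sum>k<n. c k * L (\<lambda>i. if i = e k then 1 else 0) j))
      = L (\<lambda>i. u i - s c n i)" for c n
  proof
    fix j
    have "(\<Sum>k<n. c k * L (\<lambda>i. if i = e k then 1 else 0) j)
        = (\<Sum>k<n. L (\<lambda>i. c k * (if i = e k then 1 else 0)) j)"
      by (intro sum.cong refl row_finite_cmult[OF rf, symmetric])
    also have "\<dots> = L (s c n) j"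
      unfolding s_def by (rule row_finite_sum[OF rf, symmetric]) simp
    finally show "h j - (\<Sum>k<n. c k * L (\<lambda>i. if i = e k then 1 else 0) j)
        = L (\<lambda>i. u i - s c n i) j"
      by (simp add: row_finite_diff[OF rf] Lu)
  qed
  have diff: "(\<lambda>i. u i - s c n i) \<in> ell2" for c n
    by (intro ell2_diff u s_ell2)
  have u_sum: "((\<lambda>k. (cmod (u (e k)))\<^sup>2) has_sum (ell2_norm u)\<^sup>2) UNIV"
    using has_sum_reindex_bij_betw[OF e, of "\<lambda>i. (cmod (u i))\<^sup>2"] ell2_has_sum[OF u] by simp
  have diff_norm: "(ell2_norm (\<lambda>i. u i - s (\<lambda>k. u (e k)) n i))\<^sup>2
      = (ell2_norm u)\<^sup>2 - (\<Sum>k<n. (cmod (u (e k)))\<^sup>2)" for n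
  proof (rule has_sum_imp_ell2(2))
    have "((\<lambda>k. if k < n then - (cmod (u (e k)))\<^sup>2 else 0) has_sum
        - (\<Sum>k<n. (cmod (u (e k)))\<^sup>2)) UNIV"
      by (rule has_sum_finite_neutralI[where B = "{..<n}"]) (auto simp: sum_negf)
    from has_sum_add[OF u_sum this]
    have "((\<lambda>k. (cmod (u (e k) - s (\<lambda>k. u (e k)) n (e k)))\<^sup>2) has_sum
        ((ell2_norm u)\<^sup>2 - (\<Sum>k<n. (cmod (u (e k)))\<^sup>2))) UNIV"
      unfolding diff_conv_add_uminus[of "(ell2_norm u)\<^sup>2"]
      by (rule has_sum_cong[THEN iffD1, rotated]) (simp add: s_e)
    then show "((\<lambda>i. (cmod (u i - s (\<lambda>k. u (e k)) n i))\<^sup>2) has_sum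
        ((ell2_norm u)\<^sup>2 - (\<Sum>k<n. (cmod (u (e k)))\<^sup>2))) UNIV"
      by (subst (asm) has_sum_reindex_bij_betw[OF e])
  qed
  show "\<exists>!c. (\<lambda>n. ell2_norm (\<lambda>j. h j - (\<Sum>k<n. c k * L (\<lambda>i. if i = e k then 1 else 0) j)))
      \<longlonglongrightarrow> 0"
    unfolding partial
  proof (rule ex1I[where a = "\<lambda>k. u (e k)"])
    have "(\<lambda>n. B * ((ell2_norm u)\<^sup>2 - (\<Sum>k<n. (cmod (u (e k)))\<^sup>2)))
        \<longlonglongrightarrow> B * ((ell2_norm u)\<^sup>2 - (ell2_norm u)\<^sup>2)"
      using has_sum_imp_sums[OF u_sum] unfolding sums_def by (intro tendsto_intros)
    then have lim: "(\<lambda>n. B * ((ell2_norm u)\<^sup>2 - (\<Sum>k<n. (cmod (u (e k)))\<^sup>2))) \<longlonglongrightarrow> 0"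
      by simp
    have "(\<lambda>n. (ell2_norm (L (\<lambda>i. u i - s (\<lambda>k. u (e k)) n i)))\<^sup>2) \<longlonglongrightarrow> 0"
      by (rule tendsto_sandwich[OF _ _ tendsto_const lim])
        (use L(2)[OF diff] in \<open>auto simp: diff_norm[symmetric]\<close>)
    then show "(\<lambda>n. ell2_norm (L (\<lambda>i. u i - s (\<lambda>k. u (e k)) n i))) \<longlonglongrightarrow> 0"
      using tendsto_real_sqrt[of _ 0] by (fastforce simp: ell2_norm_nonneg)
  next
    fix c
    assume "(\<lambda>n. ell2_norm (L (\<lambda>i. u i - s c n i))) \<longlonglongrightarrow> 0"
    then have "(\<lambda>n. (ell2_norm (L (\<lambda>i. u i - s c n i)))\<^sup>2 / A) \<longlonglongrightarrow> 0\<^sup>2 / A"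
      using A by (intro tendsto_intros) auto
    then have lim: "(\<lambda>n. (ell2_norm (L (\<lambda>i. u i - s c n i)))\<^sup>2 / A) \<longlonglongrightarrow> 0"
      by simp
    show "c = (\<lambda>k. u (e k))"
    proof
      fix k
      \<comment> \<open>Once \<open>n > k\<close>, coordinate \<open>e k\<close> of the truncation
        is \<open>c k\<close>, whatever \<open>n\<close> is. A fixed number is thus bounded by
        residuals that tend to 0.\<close>
      have "(cmod (u (e k) - c k))\<^sup>2 \<le> (ell2_norm (L (\<lambda>i. u i - s c n i)))\<^sup>2 / A" if "n > k" for n
      proof -
        have "(cmod (u (e k) - c k))\<^sup>2 \<le> (ell2_norm (\<lambda>i. u i - s c n i))\<^sup>2"
          using ell2_finite_sum_le[OF diff, of "{e k}" c n] that by (simp add: s_e)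
        also have "\<dots> \<le> (ell2_norm (L (\<lambda>i. u i - s c n i)))\<^sup>2 / A"
          using L(3)[OF diff, of c n] A by (simp add: pos_le_divide_eq mult.commute)
        finally show ?thesis .
      qed
      then have "(cmod (u (e k) - c k))\<^sup>2 \<le> 0"
        by (intro LIMSEQ_le_const[OF lim]) (auto intro!: exI[of _ "Suc k"])
      then show "c k = u (e k)"
        by simp
    qed
  qed
qed

section \<open>Linear systems and finite Fourier transforms\<close>

text \<open>Gaussian elimination, one equation per induction step. It serves twice: with atoms as
  unknowns it gives a dependence, with coordinates as unknowns a vector orthogonal to given
  atoms.\<close>

lemma underdetermined_system_nontrivial:
  fixes a :: "'j \<Rightarrow> 'k \<Rightarrow> complex"
  assumes "finite J" and "finite F" and "card J < card F"
  shows "\<exists>c. (\<exists>k\<in>F. c k \<noteq> 0) \<and> (\<forall>j\<in>J. (\<Sum>k\<in>F. c k * a j k) = 0)"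
  using assms
proof (induction J arbitrary: F a rule: finite_induct)
  case empty
  then have "F \<noteq> {}" by auto
  then show ?case by (intro exI[of _ "\<lambda>_. 1"]) auto
next
  case (insert i J)
  show ?case
  proof (cases "\<forall>k\<in>F. a i k = 0")
    case True
    have "card J < card F"
      using insert by simp
    then obtain c where "\<exists>k\<in>F. c k \<noteq> 0" "\<forall>j\<in>J. (\<Sum>k\<in>F. c k * a j k) = 0"
      using insert.IH[OF insert.prems(1)] by blast
    with True show ?thesis
      by (intro exI[of _ c]) auto
  next
    case False
    then obtain p where p: "p \<in> F" "a i p \<noteq> 0" by blast
    \<comment> \<open>Equation \<open>i\<close> is solved for the unknown \<open>p\<close>;
      \<open>b\<close> is the system after this substitution, and its row \<open>i\<close>
      vanishes.\<close>
    define b where "b j k = a j k - a i k / a i p * a j p" for j k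
    have "card J < card (F - {p})"
      using insert p by simp
    then obtain c where c: "\<exists>k\<in>F - {p}. c k \<noteq> 0"
        "\<forall>j\<in>J. (\<Sum>k\<in>F - {p}. c k * b j k) = 0"
      using insert.IH[of "F - {p}" b] insert.prems by blast
    define d where "d k = (if k = p then - (\<Sum>k\<in>F - {p}. c k * a i k) / a i p else c k)" for k
    have d_sum: "(\<Sum>k\<in>F. d k * a j k) = (\<Sum>k\<in>F - {p}. c k * b j k)" for j
    proof -
      have "(\<Sum>k\<in>F. d k * a j k) = d p * a j p + (\<Sum>k\<in>F - {p}. d k * a j k)"
        by (rule sum.remove[OF insert.prems(1) p(1)])
      also have "(\<Sum>k\<in>F - {p}. d k * a j k) = (\<Sum>k\<in>F - {p}. c k * a j k)"
        by (intro sum.cong) (auto simp: d_def)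
      also have "d p * a j p + \<dots> = (\<Sum>k\<in>F - {p}. c k * b j k)"
        unfolding d_def b_def
        by (simp add: algebra_simps sum_subtractf sum_distrib_right sum_distrib_left
            sum_divide_distrib)
      finally show ?thesis .
    qed
    have "b i k = 0" for k
      using p(2) by (simp add: b_def)
    then have "\<forall>j\<in>insert i J. (\<Sum>k\<in>F. d k * a j k) = 0"
      using c(2) by (simp add: d_sum)
    moreover have "\<exists>k\<in>F. d k \<noteq> 0"
      using c(1) by (auto simp: d_def)
    ultimately show ?thesis by blast
  qed
qed

text \<open>Unconditional sums may always be grouped into blocks; the converse, ungrouping, rests on
  nonnegative terms.\<close>

lemma has_sum_blocks:
  fixes M :: int and G :: "int \<Rightarrow> real"
  assumes M: "M > 0" and G: "\<And>j. 0 \<le> G j"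
  shows "(G has_sum s) UNIV \<longleftrightarrow> ((\<lambda>n. \<Sum>r\<in>{0..<M}. G (n * M + r)) has_sum s) UNIV"
    (is "?l \<longleftrightarrow> ?r")
proof -
  let ?f = "\<lambda>(n, r). n * M + r"
  have bij: "bij_betw ?f (UNIV \<times> {0..<M}) UNIV"
    by (rule bij_betw_byWitness[where f' = "\<lambda>j. (j div M, j mod M)"]) (use M in auto)
  have inner: "((\<lambda>r. G (?f (n, r))) has_sum (\<Sum>r\<in>{0..<M}. G (n * M + r))) {0..<M}" for n
    by (rule has_sum_finiteI) auto
  have "?l \<longleftrightarrow> ((\<lambda>p. G (?f p)) has_sum s) (UNIV \<times> {0..<M})"
    by (rule has_sum_reindex_bij_betw[OF bij, symmetric])
  also have "\<dots> \<longleftrightarrow> ?r"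
  proof
    assume "((\<lambda>p. G (?f p)) has_sum s) (UNIV \<times> {0..<M})"
    then show ?r
      by (rule has_sum_SigmaD) (rule inner)
  next
    assume r: ?r
    then have "(\<lambda>p. G (?f p)) summable_on (UNIV \<times> {0..<M})"
      by (intro summable_on_SigmaI[OF inner]) (auto simp: G summable_on_def)
    then show "((\<lambda>p. G (?f p)) has_sum s) (UNIV \<times> {0..<M})"
      by (rule has_sum_SigmaI[OF inner r])
  qed
  finally show ?thesis .
qed

lemma finite_parseval:
  fixes a :: "'r \<Rightarrow> 'm \<Rightarrow> complex"
  assumes "finite S"
    and orth: "\<And>m m'. m \<in> S \<Longrightarrow> m' \<in> S \<Longrightarrow>
      (\<Sum>r\<in>R. a r m * cnj (a r m')) = (if m = m' then of_real C else 0)"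
  shows "(\<Sum>r\<in>R. (cmod (\<Sum>m\<in>S. c m * a r m))\<^sup>2) = C * (\<Sum>m\<in>S. (cmod (c m))\<^sup>2)"
proof -
  have "complex_of_real (\<Sum>r\<in>R. (cmod (\<Sum>m\<in>S. c m * a r m))\<^sup>2)
      = (\<Sum>r\<in>R. \<Sum>m\<in>S. \<Sum>m'\<in>S. (c m * cnj (c m')) * (a r m * cnj (a r m')))"
    by (simp add: complex_norm_square sum_product mult_ac del: of_real_power)
  also have "\<dots> = (\<Sum>m\<in>S. \<Sum>r\<in>R. \<Sum>m'\<in>S. (c m * cnj (c m')) * (a r m * cnj (a r m')))"
    by (rule sum.swap)
  also have "\<dots> = (\<Sum>m\<in>S. \<Sum>m'\<in>S. \<Sum>r\<in>R. (c m * cnj (c m')) * (a r m * cnj (a r m')))"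
    by (intro sum.cong refl sum.swap)
  also have "\<dots> = (\<Sum>m\<in>S. \<Sum>m'\<in>S. c m * cnj (c m') * (if m = m' then of_real C else 0))"
    by (simp add: sum_distrib_left[symmetric] orth)
  also have "\<dots> = (\<Sum>m\<in>S. of_real C * (c m * cnj (c m)))"
    by (simp add: if_distrib sum.delta assms mult_ac cong: if_cong)
  also have "\<dots> = complex_of_real (C * (\<Sum>m\<in>S. (cmod (c m))\<^sup>2))"
    by (simp add: complex_norm_square sum_distrib_left del: of_real_power)
  finally show ?thesis
    by (simp only: of_real_eq_iff)
qed

section \<open>Characters of the cyclic group of order \<open>M\<close> and the blockwise Fourier
  transform\<close>

definition character :: "int \<Rightarrow> int \<Rightarrow> int \<Rightarrow> complex" where
  "character M j m = exp (2 * of_real pi * \<i> * of_int j * of_real (of_int m / of_int M))"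

lemma character_commute: "character M j m = character M m j"
  by (simp add: character_def mult_ac)

lemma character_add: "character M (j + k) m = character M j m * character M k m"
  by (simp add: character_def exp_add[symmetric] algebra_simps)

lemma character_multiple:
  assumes "M \<noteq> 0"
  shows "character M (n * M) m = 1"
  unfolding character_def exp_eq_1 using assms
  by (auto intro!: exI[of _ "n * m"])

lemma character_shift [simp]:
  assumes "M \<noteq> 0"
  shows "character M (n * M + r) m = character M r m"
  by (simp add: character_add character_multiple assms)

lemma character_mod: "M \<noteq> 0 \<Longrightarrow> character M (j mod M) m = character M j m"
  using character_shift[of M "j div M" "j mod M" m] by simp

lemma character_mult_cnj: "character M j m * cnj (character M j m') = character M j (m - m')"
  unfolding character_def
  by (simp add: exp_cnj exp_add[symmetric] algebra_simps diff_divide_distrib)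

lemma character_eq_1_iff:
  assumes "M > 0"
  shows "character M 1 d = 1 \<longleftrightarrow> M dvd d"
proof
  assume "character M 1 d = 1"
  then obtain n :: int where "2 * pi * (of_int d / of_int M) = of_int (2 * n) * pi"
    unfolding character_def exp_eq_1 by auto
  then have "of_int d = (of_int (n * M) :: real)"
    using assms by (simp add: field_simps)
  then show "M dvd d"
    unfolding of_int_eq_iff by simp
next
  assume "M dvd d"
  then show "character M 1 d = 1"
    using character_multiple[of M _ 1] assms
    by (auto simp: character_commute[of M 1] mult.commute elim!: dvdE)
qed

text \<open>A geometric sum whose ratio \<open>z\<close> is an \<open>M\<close>-th root of unity,
  different from 1 for distinct \<open>m\<close> and \<open>m'\<close> because \<open>M\<close>
  cannot divide their difference.\<close>

lemma character_orthogonal: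
  assumes M: "M > 0" and m: "m \<in> {0..<M}" "m' \<in> {0..<M}"
  shows "(\<Sum>r\<in>{0..<M}. character M r m * cnj (character M r m')) = (if m = m' then of_int M else 0)"
proof -
  define z where "z = character M 1 (m - m')"
  have pow: "character M (int k) (m - m') = z ^ k" for k
    by (induction k) (simp_all add: z_def character_add, simp add: character_def)
  have "(\<Sum>r\<in>{0..<M}. character M r m * cnj (character M r m'))
      = (\<Sum>r\<in>{0..<M}. character M r (m - m'))"
    by (simp add: character_mult_cnj)
  also have "\<dots> = (\<Sum>k<nat M. z ^ k)"
    by (rule sum.reindex_bij_witness[of _ int nat]) (auto simp: pow[symmetric])
  also have "\<dots> = (if m = m' then of_int M else 0)"
  proof (cases "m = m'")
    case True
    then show ?thesis using M by (simp add: z_def character_def)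
  next
    case False
    then have "\<not> M dvd (m - m')"
      using m by (metis atLeastLessThan_iff mod_eq_dvd_iff mod_pos_pos_trivial)
    then have "z \<noteq> 1"
      using character_eq_1_iff[OF M] by (simp add: z_def)
    moreover have "z ^ nat M = 1"
      using pow[of "nat M"] character_multiple[of M 1 "m - m'"] M by simp
    ultimately show ?thesis
      using False by (simp add: geometric_sum)
  qed
  finally show ?thesis .
qed

text \<open>The unnormalized discrete Fourier transform on each block of \<open>M\<close>
  consecutive integers. The input position \<open>n * M + m\<close> stands for the Gabor index
  \<open>(n, m)\<close>; the output position is a time. Characters have period \<open>M\<close> in
  \<open>j\<close>, so \<open>j\<close> need not be reduced.\<close>

definition block_dft :: "int \<Rightarrow> (int \<Rightarrow> complex) \<Rightarrow> int \<Rightarrow> complex" where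
  "block_dft M c j = (\<Sum>m\<in>{0..<M}. c (j div M * M + m) * character M j m)"

lemma block_dft_block:
  assumes "r \<in> {0..<M}"
  shows "block_dft M c (n * M + r) = (\<Sum>m\<in>{0..<M}. c (n * M + m) * character M r m)"
  using assms unfolding block_dft_def by simp

lemma row_finite_block_dft: "row_finite (block_dft M)"
proof -
  have eq: "block_dft M = (\<lambda>c j. \<Sum>m\<in>{0..<M}. character M j m * c (j div M * M + m))"
    by (intro ext) (simp add: block_dft_def mult.commute)
  show ?thesis
    unfolding eq by (rule row_finiteI) (simp_all add: inj_on_def)
qed

text \<open>Parseval's identity block by block. Both directions are used: from frame coefficients
  back to the analysis sequence, and from a coefficient sequence to its transform.\<close>

lemma block_dft_has_sum_iff:
  assumes M: "M > 0"
  shows "((\<lambda>j. (cmod (block_dft M c j))\<^sup>2) has_sum (of_int M * s)) UNIV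
    \<longleftrightarrow> ((\<lambda>j. (cmod (c j))\<^sup>2) has_sum s) UNIV"
proof -
  have orth: "(\<Sum>r\<in>{0..<M}. character M r m * cnj (character M r m'))
      = (if m = m' then of_real (of_int M) else 0)" if "m \<in> {0..<M}" "m' \<in> {0..<M}" for m m'
    by (simp only: character_orthogonal[OF M that] of_real_of_int_eq)
  have blocks: "(\<Sum>r\<in>{0..<M}. (cmod (block_dft M c (n * M + r)))\<^sup>2)
      = of_int M * (\<Sum>m\<in>{0..<M}. (cmod (c (n * M + m)))\<^sup>2)" for n
  proof -
    have "(\<Sum>r\<in>{0..<M}. (cmod (block_dft M c (n * M + r)))\<^sup>2)
        = (\<Sum>r\<in>{0..<M}. (cmod (\<Sum>m\<in>{0..<M}. c (n * M + m) * character M r m))\<^sup>2)"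
      by (intro sum.cong refl) (simp only: block_dft_block)
    also have "\<dots> = of_int M * (\<Sum>m\<in>{0..<M}. (cmod (c (n * M + m)))\<^sup>2)"
      by (rule finite_parseval[OF finite_atLeastLessThan_int orth])
    finally show ?thesis .
  qed
  have "((\<lambda>j. (cmod (block_dft M c j))\<^sup>2) has_sum (of_int M * s)) UNIV
      \<longleftrightarrow> ((\<lambda>n. of_int M * (\<Sum>m\<in>{0..<M}. (cmod (c (n * M + m)))\<^sup>2)) has_sum (of_int M * s)) UNIV"
    by (subst has_sum_blocks[OF M]) (simp_all only: blocks zero_le_power2)
  also have "\<dots> \<longleftrightarrow> ((\<lambda>n. \<Sum>m\<in>{0..<M}. (cmod (c (n * M + m)))\<^sup>2) has_sum s) UNIV"
    using M by (subst has_sum_cmult_right_iff) simp_all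
  also have "\<dots> \<longleftrightarrow> ((\<lambda>j. (cmod (c j))\<^sup>2) has_sum s) UNIV"
    by (rule has_sum_blocks[OF M, symmetric]) simp
  finally show ?thesis .
qed

lemma block_dft_ell2:
  assumes "M > 0" and "c \<in> ell2"
  shows "block_dft M c \<in> ell2"
    and "(ell2_norm (block_dft M c))\<^sup>2 = of_int M * (ell2_norm c)\<^sup>2"
  using has_sum_imp_ell2 block_dft_has_sum_iff[OF assms(1)] ell2_has_sum[OF assms(2)] by blast+

text \<open>Conjugating before and after a transform conjugates its characters. As
  \<open>character M\<close> is symmetric in its last two arguments, this is the inverse transform
  up to the factor \<open>M\<close>.\<close>

lemma block_dft_inverse:
  assumes M: "M > 0"
  shows "block_dft M (\<lambda>i. cnj (block_dft M (\<lambda>k. cnj (v k)) i)) j = of_int M * v j"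
proof -
  define b where "b = j div M * M"
  have "block_dft M (\<lambda>i. cnj (block_dft M (\<lambda>k. cnj (v k)) i)) j
      = (\<Sum>m\<in>{0..<M}. (\<Sum>r\<in>{0..<M}. v (b + r) * cnj (character M m r)) * character M j m)"
    unfolding block_dft_def[of M _ j] b_def[symmetric]
    by (intro sum.cong refl) (simp add: b_def block_dft_block)
  also have "\<dots> = (\<Sum>r\<in>{0..<M}. v (b + r)
      * (\<Sum>m\<in>{0..<M}. character M m (j mod M) * cnj (character M m r)))"
    unfolding sum_distrib_right sum_distrib_left
    using M by (subst sum.swap)
      (simp add: character_commute[of M _ "j mod M"] character_mod mult_ac)
  also have "\<dots> = (\<Sum>r\<in>{0..<M}. v (b + r) * (if j mod M = r then of_int M else 0))"
    using M by (intro sum.cong refl) (simp add: character_orthogonal)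
  also have "\<dots> = of_int M * v j"
    using M by (simp add: if_distrib b_def mult.commute cong: if_cong)
  finally show ?thesis .
qed


section \<open>Synthesis and analysis on residue classes\<close>

text \<open>A range of \<open>t\<close> common to all residues: it contains the support of
  \<open>t -> g (r + t * M)\<close> for every \<open>r\<close> in \<open>{0..<M}\<close>.\<close>

definition support_blocks :: "int \<Rightarrow> (int \<Rightarrow> complex) \<Rightarrow> int set" where
  "support_blocks M g = (\<lambda>i. i div M) ` {i. g i \<noteq> 0}"

text \<open>On the residue class of \<open>r\<close>, convolution in the block number with the
  kernel \<open>t -> g (r + t * M)\<close>; \<open>fiber_analysis\<close> is correlation with the
  same kernel.\<close>

definition fiber_synthesis ::
    "int \<Rightarrow> (int \<Rightarrow> complex) \<Rightarrow> (int \<Rightarrow> complex) \<Rightarrow> int \<Rightarrow> complex" where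
  "fiber_synthesis M g u j = (\<Sum>t\<in>support_blocks M g. g (j mod M + t * M) * u (j - t * M))"

definition fiber_analysis ::
    "int \<Rightarrow> (int \<Rightarrow> complex) \<Rightarrow> (int \<Rightarrow> complex) \<Rightarrow> int \<Rightarrow> complex" where
  "fiber_analysis M g h j =
     (\<Sum>t\<in>support_blocks M g. cnj (g (j mod M + t * M)) * h (j + t * M))"

lemma finite_support_blocks: "finite {i. g i \<noteq> 0} \<Longrightarrow> finite (support_blocks M g)"
  unfolding support_blocks_def by simp

lemma row_finite_fiber_synthesis:
  assumes "M \<noteq> 0" and "finite {i. g i \<noteq> 0}"
  shows "row_finite (fiber_synthesis M g)"
  unfolding fiber_synthesis_def
  by (rule row_finiteI) (use assms in \<open>auto simp: inj_on_def finite_support_blocks\<close>)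

lemma row_finite_fiber_analysis:
  assumes "M \<noteq> 0" and "finite {i. g i \<noteq> 0}"
  shows "row_finite (fiber_analysis M g)"
  unfolding fiber_analysis_def
  by (rule row_finiteI) (use assms in \<open>auto simp: inj_on_def finite_support_blocks\<close>)

lemma block_eq_iff:
  fixes M :: int
  assumes r: "r \<in> {0..<M}" "r' \<in> {0..<M}"
  shows "n * M + r = n' * M + r' \<longleftrightarrow> n = n' \<and> r = r'"
proof
  assume eq: "n * M + r = n' * M + r'"
  have "n = (n * M + r) div M" "r = (n * M + r) mod M"
    using r by simp_all
  moreover have "n' = (n' * M + r') div M" "r' = (n' * M + r') mod M"
    using r by simp_all
  ultimately show "n = n' \<and> r = r'"
    using eq by simp
qed simp

lemma bij_int_shift: "bij (\<lambda>j::int. j + a)" "bij (\<lambda>j::int. j - a)"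
  by (rule bij_betw_byWitness[where f' = "\<lambda>j. j - a"], auto)
    (rule bij_betw_byWitness[where f' = "\<lambda>j. j + a"], auto)

lemma fiber_summand_ell2:
  assumes "finite {i. g i \<noteq> 0}" and "h \<in> ell2"
  shows "(\<lambda>j. cnj (g (j mod M + t * M)) * h (j + t * M)) \<in> ell2"
  by (rule ell2_mult_bounded[where C = "ell2_norm g"])
    (use assms in \<open>auto simp: ell2_reindex(1)[OF bij_int_shift(1)]
      intro: ell2_cmod_le ell2_finite_support\<close>)

lemma fiber_analysis_ell2:
  assumes "finite {i. g i \<noteq> 0}" and "h \<in> ell2"
  shows "fiber_analysis M g h \<in> ell2"
  unfolding fiber_analysis_def
  by (intro ell2_sum finite_support_blocks fiber_summand_ell2 assms)

lemma has_sum_finite_sum: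
  fixes f :: "'t \<Rightarrow> 'a \<Rightarrow> complex"
  assumes "finite T" and "\<And>t. t \<in> T \<Longrightarrow> (f t has_sum s t) A"
  shows "((\<lambda>x. \<Sum>t\<in>T. f t x) has_sum (\<Sum>t\<in>T. s t)) A"
  using assms by (induction T rule: finite_induct) (auto intro: has_sum_add)

text \<open>Both inner products are finite sums over \<open>t\<close> of series in \<open>j\<close>.
  For fixed \<open>t\<close> the two series differ by the shift \<open>j - t * M\<close>, which
  preserves \<open>j mod M\<close> and hence the weight.\<close>

lemma fiber_adjoint:
  assumes M: "M \<noteq> 0" and g: "finite {i. g i \<noteq> 0}" and u: "u \<in> ell2" and v: "v \<in> ell2"
  shows "ell2_inner (fiber_synthesis M g u) v = ell2_inner u (fiber_analysis M g v)"
proof -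
  define X where "X t j = u j * cnj (cnj (g (j mod M + t * M)) * v (j + t * M))" for t j
  have X: "(X t) summable_on UNIV" for t
    unfolding X_def by (intro ell2_inner_summable u fiber_summand_ell2 g v)
  have shift: "((\<lambda>j. X t (j - t * M)) has_sum infsum (X t) UNIV) UNIV" for t
    unfolding has_sum_reindex_bij_betw[OF bij_int_shift(2), of "X t"] using X by simp
  have mod: "(j - t * M) mod M = j mod M" for j t
    using mod_mult_self1[of j "-t" M] by simp
  have "((\<lambda>j. \<Sum>t\<in>support_blocks M g. X t (j - t * M)) has_sum
      (\<Sum>t\<in>support_blocks M g. infsum (X t) UNIV)) UNIV"
    by (intro has_sum_finite_sum finite_support_blocks g shift)
  moreover have "(\<Sum>t\<in>support_blocks M g. X t (j - t * M)) = fiber_synthesis M g u j * cnj (v j)" for j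
    unfolding X_def fiber_synthesis_def sum_distrib_right by (simp add: mod mult_ac)
  moreover have "((\<lambda>j. \<Sum>t\<in>support_blocks M g. X t j) has_sum
      (\<Sum>t\<in>support_blocks M g. infsum (X t) UNIV)) UNIV"
    by (intro has_sum_finite_sum finite_support_blocks g) (use X in simp)
  moreover have "(\<Sum>t\<in>support_blocks M g. X t j) = u j * cnj (fiber_analysis M g v j)" for j
    unfolding X_def fiber_analysis_def by (simp add: sum_distrib_left)
  ultimately show ?thesis
    unfolding ell2_inner_def by (simp add: infsumI)
qed

text \<open>Negation of the block number within each residue class; plain negation of
  \<open>j\<close> would permute the classes.\<close>

definition block_reflection :: "int \<Rightarrow> int \<Rightarrow> int" where
  "block_reflection M j = - (j div M) * M + j mod M"

lemma block_reflection_block: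
  assumes "r \<in> {0..<M}"
  shows "block_reflection M (n * M + r) = - n * M + r"
  using assms unfolding block_reflection_def by simp

lemma bij_block_reflection:
  assumes "M > 0"
  shows "bij (block_reflection M)"
proof (rule involuntory_imp_bij)
  fix j
  show "block_reflection M (block_reflection M j) = j"
    using assms block_reflection_block[of "j mod M" M "- (j div M)"]
    by (simp add: block_reflection_def[of M j])
qed

text \<open>
  On each residue class the synthesis operator is a convolution, hence normal: reflecting the
  class turns it into its adjoint. This is what makes a frame bound a Riesz bound.
\<close>

lemma fiber_synthesis_reflection:
  assumes M: "M > 0"
  shows "fiber_synthesis M g u j
    = cnj (fiber_analysis M g (\<lambda>i. cnj (u (block_reflection M i))) (block_reflection M j))"
proof -
  have "block_reflection M (block_reflection M j + t * M) = j - t * M" for t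
  proof -
    have "block_reflection M j + t * M = (t - j div M) * M + j mod M"
      by (simp add: block_reflection_def algebra_simps)
    then have "block_reflection M (block_reflection M j + t * M) = - (t - j div M) * M + j mod M"
      using M block_reflection_block[of "j mod M" M "t - j div M"] by simp
    also have "\<dots> = j div M * M + j mod M - t * M"
      by (simp add: left_diff_distrib del: div_mult_mod_eq mod_div_mult_eq)
    also have "\<dots> = j - t * M"
      by simp
    finally show ?thesis .
  qed
  moreover have "block_reflection M j mod M = j mod M"
    unfolding block_reflection_def by (metis add.commute mod_mod_trivial mod_mult_self1)
  ultimately show ?thesis
    unfolding fiber_synthesis_def fiber_analysis_def by simp
qed

lemma ell2_cnj: "(\<lambda>j. cnj (f j)) \<in> ell2 \<longleftrightarrow> f \<in> ell2" "ell2_norm (\<lambda>j. cnj (f j)) = ell2_norm f"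
  unfolding ell2_def ell2_norm_def by auto

text \<open>Reflection and conjugation preserve norms, so norm bounds for
  \<open>fiber_analysis M g\<close> pass to \<open>fiber_synthesis M g\<close> with the same
  constants.\<close>

lemma fiber_synthesis_norm:
  assumes "M > 0" and g: "finite {i. g i \<noteq> 0}" and "u \<in> ell2"
  defines "v \<equiv> \<lambda>i. cnj (u (block_reflection M i))"
  shows "v \<in> ell2" and "ell2_norm v = ell2_norm u"
    and "fiber_synthesis M g u \<in> ell2"
    and "ell2_norm (fiber_synthesis M g u) = ell2_norm (fiber_analysis M g v)"
proof -
  note bij = bij_block_reflection[OF assms(1)]
  show v: "v \<in> ell2" and "ell2_norm v = ell2_norm u"
    using assms(3) unfolding v_def ell2_cnj
    by (auto simp: ell2_reindex(1)[OF bij, of u] ell2_reindex(2)[OF bij, of u])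
  have eq: "fiber_synthesis M g u = (\<lambda>j. cnj (fiber_analysis M g v (block_reflection M j)))"
    unfolding v_def by (rule ext) (rule fiber_synthesis_reflection[OF assms(1)])
  show "fiber_synthesis M g u \<in> ell2"
    unfolding eq ell2_cnj ell2_reindex(1)[OF bij, of "fiber_analysis M g v"]
    by (rule fiber_analysis_ell2[OF g v])
  show "ell2_norm (fiber_synthesis M g u) = ell2_norm (fiber_analysis M g v)"
    unfolding eq ell2_cnj ell2_reindex(2)[OF bij, of "fiber_analysis M g v"] by simp
qed

section \<open>Gabor systems\<close>

lemma gabor_system_apply:
  "gabor_system M N g (n, m) = (\<lambda>j. character (int M) j (int m) * g (j - n * int N))"
  unfolding gabor_system_def modulation_def translation_def character_def by simp

text \<open>Write \<open>j - n * M = t * M + r\<close> with \<open>r\<close> a residue. The sum over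
  \<open>t\<close> is the analysis sequence at \<open>n * M + r\<close>; the character sees only
  \<open>r\<close>, because the translation step equals its period, so the sum over \<open>r\<close>
  is a conjugated Fourier sum.\<close>

lemma inner_gabor_atom:
  assumes M: "M > 0" and g: "finite {i. g i \<noteq> 0}" and m: "m \<in> {0..<M}"
  shows "ell2_inner h (\<lambda>j. character M j m * g (j - n * M))
    = cnj (block_dft M (\<lambda>i. cnj (fiber_analysis M g h i)) (n * M + m))"
proof -
  define F where "F j = h j * cnj (character M j m * g (j - n * M))" for j
  define T where "T = support_blocks M g"
  have T: "finite T"
    unfolding T_def by (rule finite_support_blocks[OF g])
  define \<phi> where "\<phi> = (\<lambda>(r, t). n * M + (t * M + r))"
  have inj: "inj_on \<phi> ({0..<M} \<times> T)"
  proof (rule inj_onI, clarify)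
    fix r t r' t'
    assume *: "r \<in> {0..<M}" "r' \<in> {0..<M}" and "\<phi> (r, t) = \<phi> (r', t')"
    then show "r = r' \<and> t = t'"
      using block_eq_iff[OF *] by (simp add: \<phi>_def)
  qed
  have zero: "F j = 0" if "j \<notin> \<phi> ` ({0..<M} \<times> T)" for j
  proof (rule ccontr)
    assume "F j \<noteq> 0"
    then have "(j - n * M) div M \<in> T"
      unfolding F_def T_def support_blocks_def by auto
    then have "\<phi> ((j - n * M) mod M, (j - n * M) div M) \<in> \<phi> ` ({0..<M} \<times> T)"
      using M by (intro imageI) simp
    moreover have "\<phi> ((j - n * M) mod M, (j - n * M) div M) = j"
      by (simp add: \<phi>_def)
    ultimately show False using that by simp
  qed
  have "ell2_inner h (\<lambda>j. character M j m * g (j - n * M)) = infsum F UNIV"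
    unfolding ell2_inner_def F_def ..
  also have "\<dots> = infsum F (\<phi> ` ({0..<M} \<times> T))"
    by (rule infsum_cong_neutral) (auto simp: zero)
  also have "\<dots> = sum F (\<phi> ` ({0..<M} \<times> T))"
    using T by (intro infsum_finite) auto
  also have "\<dots> = (\<Sum>r\<in>{0..<M}. \<Sum>t\<in>T. F (n * M + (t * M + r)))"
    unfolding sum.reindex[OF inj] by (simp add: \<phi>_def sum.cartesian_product split_def)
  also have "\<dots> = (\<Sum>r\<in>{0..<M}. fiber_analysis M g h (n * M + r) * cnj (character M m r))"
  proof (rule sum.cong[OF refl])
    fix r assume r: "r \<in> {0..<M}"
    have "F (n * M + (t * M + r))
        = cnj (g ((n * M + r) mod M + t * M)) * h (n * M + r + t * M) * cnj (character M m r)" for t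
    proof -
      have "character M (n * M + (t * M + r)) m = character M m r"
        using M by (simp add: character_commute[of M m r])
      then show ?thesis
        using r by (simp add: F_def algebra_simps)
    qed
    then show "(\<Sum>t\<in>T. F (n * M + (t * M + r)))
        = fiber_analysis M g h (n * M + r) * cnj (character M m r)"
      unfolding fiber_analysis_def T_def[symmetric] sum_distrib_right by simp
  qed
  also have "\<dots> = cnj (block_dft M (\<lambda>i. cnj (fiber_analysis M g h i)) (n * M + m))"
    unfolding block_dft_block[OF m] by simp
  finally show ?thesis .
qed

text \<open>The transform of the unit vector at \<open>n * M + m\<close> is a character cut off to
  block \<open>n\<close>, and convolution keeps the single term \<open>t = j div M - n\<close>.
  Hence one operator maps the unit vectors to the whole critical Gabor system.\<close>

lemma gabor_atom_synthesis:
  assumes M: "M > 0" and g: "finite {i. g i \<noteq> 0}" and m: "m \<in> {0..<M}"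
  shows "fiber_synthesis M g (block_dft M (\<lambda>i. if i = n * M + m then 1 else 0))
    = (\<lambda>j. character M j m * g (j - n * M))"
proof
  fix j
  have dft: "block_dft M (\<lambda>i. if i = n * M + m then 1 else 0) i
      = (if i div M = n then character M i m else 0)" for i
  proof -
    have "i div M * M + m' = n * M + m \<longleftrightarrow> i div M = n \<and> m' = m" if "m' \<in> {0..<M}" for m'
      by (rule block_eq_iff[OF that m])
    then have "block_dft M (\<lambda>i. if i = n * M + m then 1 else 0) i
        = (\<Sum>m'\<in>{0..<M}. if m' = m then (if i div M = n then character M i m else 0) else 0)"
      unfolding block_dft_def by (intro sum.cong) auto
    also have "\<dots> = (if i div M = n then character M i m else 0)"
      using m by (simp add: sum.delta)
    finally show ?thesis .
  qed
  have div: "(j - t * M) div M = j div M - t" for t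
    using M div_mult_self1[of M j "-t"] by simp
  have char: "character M (j - t * M) m = character M j m" for t
    using character_shift[of M "-t" j m] M by simp
  have arg: "j mod M + (j div M - n) * M = j - n * M"
    using div_mult_mod_eq[of j M] by (simp add: algebra_simps)
  have "fiber_synthesis M g (block_dft M (\<lambda>i. if i = n * M + m then 1 else 0)) j
      = (\<Sum>t\<in>support_blocks M g. if t = j div M - n
          then g (j mod M + t * M) * character M j m else 0)"
    unfolding fiber_synthesis_def dft div char by (intro sum.cong) auto
  also have "\<dots> = (if j div M - n \<in> support_blocks M g then g (j - n * M) * character M j m else 0)"
    by (simp add: sum.delta' finite_support_blocks[OF g] arg)
  \<comment> \<open>Outside \<open>support_blocks M g\<close> the value \<open>g (j - n * M)\<close>
    is 0, so the case distinction disappears.\<close>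
  also have "\<dots> = character M j m * g (j - n * M)"
  proof (cases "g (j - n * M) = 0")
    case False
    then have "(j - n * M) div M \<in> support_blocks M g"
      unfolding support_blocks_def by auto
    then show ?thesis by (simp add: div)
  qed simp
  finally show "fiber_synthesis M g (block_dft M (\<lambda>i. if i = n * M + m then 1 else 0)) j
      = character M j m * g (j - n * M)" .
qed


section \<open>Critical density: frames with \<open>M = N\<close> are bases\<close>

lemma bij_gabor_index:
  assumes "M \<ge> 1"
  shows "bij_betw (\<lambda>(n, m). n * int M + int m) (gabor_index M) UNIV"
  by (rule bij_betw_byWitness[where f' = "\<lambda>j. (j div int M, nat (j mod int M))"])
    (use assms in \<open>auto simp: gabor_index_def nat_less_iff\<close>)

text \<open>Up to conjugation, the frame coefficients are the block transform of the conjugated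
  analysis sequence. The transform multiplies squared norms by \<open>M\<close>, whence the
  constants \<open>A / M\<close> and \<open>B / M\<close>.\<close>

lemma frame_fiber_analysis_bounds:
  assumes M: "M \<ge> 1" and g: "finite {j. g j \<noteq> 0}"
    and frame: "ell2_frame (gabor_index M) (gabor_system M M g)"
  obtains A B where "A > 0" and "B > 0"
    and "\<And>h. h \<in> ell2 \<Longrightarrow> A * (ell2_norm h)\<^sup>2 \<le> (ell2_norm (fiber_analysis (int M) g h))\<^sup>2"
    and "\<And>h. h \<in> ell2 \<Longrightarrow> (ell2_norm (fiber_analysis (int M) g h))\<^sup>2 \<le> B * (ell2_norm h)\<^sup>2"
proof -
  let ?f = "gabor_system M M g"
  have M': "int M > 0"
    using M by simp
  obtain A B where AB: "A > 0" "B > 0"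
    and sumd: "\<And>h. h \<in> ell2 \<Longrightarrow> (\<lambda>k. (cmod (ell2_inner h (?f k)))\<^sup>2) summable_on gabor_index M"
    and lower: "\<And>h. h \<in> ell2 \<Longrightarrow> A * (ell2_norm h)\<^sup>2
      \<le> (\<Sum>\<^sub>\<infinity>k\<in>gabor_index M. (cmod (ell2_inner h (?f k)))\<^sup>2)"
    and upper: "\<And>h. h \<in> ell2 \<Longrightarrow> (\<Sum>\<^sub>\<infinity>k\<in>gabor_index M. (cmod (ell2_inner h (?f k)))\<^sup>2)
      \<le> B * (ell2_norm h)\<^sup>2"
    using frame unfolding ell2_frame_def by blast
  have energy: "(\<Sum>\<^sub>\<infinity>k\<in>gabor_index M. (cmod (ell2_inner h (?f k)))\<^sup>2)
      = M * (ell2_norm (fiber_analysis (int M) g h))\<^sup>2" if h: "h \<in> ell2" for h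
  proof -
    define S where "S = (\<Sum>\<^sub>\<infinity>k\<in>gabor_index M. (cmod (ell2_inner h (?f k)))\<^sup>2)"
    define a where "a = (\<lambda>i. cnj (fiber_analysis (int M) g h i))"
    have "((\<lambda>k. (cmod (ell2_inner h (?f k)))\<^sup>2) has_sum S) (gabor_index M)"
      unfolding S_def using sumd[OF h] by simp
    moreover have "(cmod (ell2_inner h (?f k)))\<^sup>2
        = (cmod (block_dft (int M) a (case k of (n, m) \<Rightarrow> n * int M + int m)))\<^sup>2"
      if "k \<in> gabor_index M" for k
    proof -
      obtain n m where k: "k = (n, m)" "m < M"
        using \<open>k \<in> gabor_index M\<close> unfolding gabor_index_def by auto
      then show ?thesis
        using inner_gabor_atom[OF M' g, of "int m" h n] by (simp add: gabor_system_apply a_def)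
    qed
    ultimately have "((\<lambda>k. (cmod (block_dft (int M) a (case k of (n, m) \<Rightarrow> n * int M + int m)))\<^sup>2)
        has_sum S) (gabor_index M)"
      by (simp cong: has_sum_cong)
    then have "((\<lambda>j. (cmod (block_dft (int M) a j))\<^sup>2) has_sum S) UNIV"
      by (rule has_sum_reindex_bij_betw[OF bij_gabor_index[OF M], THEN iffD1])
    moreover have "S = of_int (int M) * (S / M)"
      using M by simp
    ultimately have "((\<lambda>j. (cmod (a j))\<^sup>2) has_sum (S / M)) UNIV"
      using block_dft_has_sum_iff[OF M', of a "S / M"] by simp
    then have "(ell2_norm a)\<^sup>2 = S / M"
      by (rule has_sum_imp_ell2)
    then show ?thesis
      using M unfolding S_def[symmetric] a_def ell2_cnj by simp
  qed
  show thesis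
  proof (rule that[of "A / M" "B / M"])
    show "A / M > 0" "B / M > 0"
      using AB M by simp_all
    fix h assume h: "h \<in> ell2"
    show "A / M * (ell2_norm h)\<^sup>2 \<le> (ell2_norm (fiber_analysis (int M) g h))\<^sup>2"
      using lower[OF h] M by (simp add: energy[OF h] field_simps)
    show "(ell2_norm (fiber_analysis (int M) g h))\<^sup>2 \<le> B / M * (ell2_norm h)\<^sup>2"
      using upper[OF h] M by (simp add: energy[OF h] field_simps)
  qed
qed

lemma critical_gabor_frame_basis:
  assumes M: "M \<ge> 1" and g: "finite {j. g j \<noteq> 0}"
    and frame: "ell2_frame (gabor_index M) (gabor_system M M g)"
  shows "ell2_basis (gabor_index M) (gabor_system M M g)"
proof -
  have M': "int M > 0"
    using M by simp
  let ?P = "fiber_synthesis (int M) g" and ?D = "block_dft (int M)"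
  obtain A B where AB: "A > 0" "B > 0"
    and lower: "\<And>h. h \<in> ell2 \<Longrightarrow> A * (ell2_norm h)\<^sup>2 \<le> (ell2_norm (fiber_analysis (int M) g h))\<^sup>2"
    and upper: "\<And>h. h \<in> ell2 \<Longrightarrow> (ell2_norm (fiber_analysis (int M) g h))\<^sup>2 \<le> B * (ell2_norm h)\<^sup>2"
    using frame_fiber_analysis_bounds[OF assms] by blast
  note P = fiber_synthesis_norm[OF M' g]
  \<comment> \<open>The lower frame bound enters twice: here, through the reflection, to bound
    synthesis from below, and in \<open>surj\<close> as a bound for the adjoint.\<close>
  have P_lower: "A * (ell2_norm u)\<^sup>2 \<le> (ell2_norm (?P u))\<^sup>2"
    and P_upper: "(ell2_norm (?P u))\<^sup>2 \<le> B * (ell2_norm u)\<^sup>2" if "u \<in> ell2" for u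
    using lower[OF P(1)[OF that]] upper[OF P(1)[OF that]] P(2,4)[OF that] by simp_all
  have rf: "row_finite ?P" "row_finite (fiber_analysis (int M) g)"
    using row_finite_fiber_synthesis row_finite_fiber_analysis M' g by simp_all
  have surj: "\<exists>u\<in>ell2. ?P (?D u) = h" if h: "h \<in> ell2" for h
  proof -
    obtain v where v: "v \<in> ell2" "?P v = h"
      using surj_of_adjoint_bounded_below[OF rf P(3) P_upper
          fiber_analysis_ell2[OF g] lower fiber_adjoint[OF _ g] AB h] M' by auto
    \<comment> \<open>The inverse block transform of \<open>v\<close>, as given by
      \<open>block_dft_inverse\<close>.\<close>
    define u where "u = (\<lambda>i. (1 / of_nat M) * cnj (?D (\<lambda>k. cnj (v k)) i))"
    have "u \<in> ell2"
      unfolding u_def using v(1) by (intro ell2_cmult) (simp add: ell2_cnj block_dft_ell2[OF M'])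
    moreover have "?D u = v"
      unfolding u_def using M
      by (intro ext) (simp only: row_finite_cmult[OF row_finite_block_dft] block_dft_inverse[OF M'], simp)
    ultimately show ?thesis
      using v(2) by blast
  qed
  \<comment> \<open>The factor \<open>M\<close> in both constants is the scaling of squared norms by
    \<open>block_dft\<close>.\<close>
  have "ell2_schauder_basis (\<lambda>k. ?P (?D (\<lambda>i. if i = int_decode k then 1 else 0)))"
  proof (rule schauder_basis_of_isomorphism[where A = "A * M" and B = "B * M"])
    show "row_finite (\<lambda>u. ?P (?D u))"
      by (rule row_finite_compose[OF rf(1) row_finite_block_dft])
    fix u assume u: "u \<in> ell2"
    note D = block_dft_ell2[OF M' u]
    show "?P (?D u) \<in> ell2"
      by (rule P(3)[OF D(1)])
    show "(ell2_norm (?P (?D u)))\<^sup>2 \<le> B * M * (ell2_norm u)\<^sup>2"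
      using P_upper[OF D(1)] by (simp add: D(2) mult.assoc)
    show "A * M * (ell2_norm u)\<^sup>2 \<le> (ell2_norm (?P (?D u)))\<^sup>2"
      using P_lower[OF D(1)] by (simp add: D(2) mult.assoc)
  qed (use surj AB M bij_int_decode in auto)
  \<comment> \<open>\<open>e k\<close> is the Gabor index encoded by the integer
    \<open>int_decode k\<close>, so the enumeration of atoms matches that of the unit
    vectors.\<close>
  define e where "e k = (int_decode k div int M, nat (int_decode k mod int M))" for k
  have e: "bij_betw e UNIV (gabor_index M)"
  proof -
    have "bij_betw (\<lambda>j. (j div int M, nat (j mod int M))) UNIV (gabor_index M)"
      by (rule bij_betw_byWitness[where f' = "\<lambda>(n, m). n * int M + int m"])
        (use M in \<open>auto simp: gabor_index_def nat_less_iff\<close>)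
    from bij_betw_trans[OF bij_int_decode this] show ?thesis
      unfolding e_def[abs_def] comp_def .
  qed
  have "gabor_system M M g (e k) = ?P (?D (\<lambda>i. if i = int_decode k then 1 else 0))" for k
    using gabor_atom_synthesis[OF M' g, of "int_decode k mod int M" "int_decode k div int M"] M'
    by (simp add: e_def gabor_system_apply)
  with \<open>ell2_schauder_basis _\<close> e show ?thesis
    unfolding ell2_basis_def by auto
qed

section \<open>Counting arguments off the critical density\<close>

lemma finite_support_bound:
  fixes g :: "int \<Rightarrow> complex"
  assumes "finite {j. g j \<noteq> 0}"
  obtains L :: nat where "\<And>j. g j \<noteq> 0 \<Longrightarrow> \<bar>j\<bar> \<le> int L"
proof
  fix j assume "g j \<noteq> 0"
  \<comment> \<open>The bound is a sum rather than a maximum, so \<open>g = 0\<close> needs no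
    separate case.\<close>
  then have "nat \<bar>j\<bar> \<le> (\<Sum>i\<in>{j. g j \<noteq> 0}. nat \<bar>i\<bar>)"
    using assms by (intro member_le_sum) auto
  then show "\<bar>j\<bar> \<le> int (\<Sum>i\<in>{j. g j \<noteq> 0}. nat \<bar>i\<bar>)"
    by linarith
qed

lemma oversampled_gabor_dependent:
  assumes "N < M" and g: "finite {j. g j \<noteq> 0}"
  shows "linearly_dependent_family (gabor_index M) (gabor_system M N g)"
proof -
  obtain L :: nat where L: "\<And>j. g j \<noteq> 0 \<Longrightarrow> \<bar>j\<bar> \<le> int L"
    using finite_support_bound[OF g] by blast
  \<comment> \<open>\<open>K\<close> consecutive translates give \<open>K * M\<close> atoms
    supported in \<open>J\<close>, which has \<open>K * N + 2 * L + 1\<close> points. Since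
    \<open>K * M\<close> is at least \<open>K * N + K\<close>, it suffices that \<open>K\<close>
    exceeds \<open>2 * L + 1\<close>.\<close>
  define K where "K = 2 * L + 2"
  define F where "F = {0..<int K} \<times> {0..<M}"
  define J where "J = {- int L..int (K * N + L)}"
  have "K * N + K \<le> K * M"
    using assms(1) by (metis Suc_leI mult_Suc_right mult_le_mono2 add.commute)
  moreover have "card F = K * M"
    unfolding F_def by (simp add: card_cartesian_product)
  moreover have "card J = K * N + 2 * L + 1"
  proof -
    have "int (K * N + L) - - int L + 1 = int (K * N + 2 * L + 1)"
      by simp
    then show ?thesis
      unfolding J_def card_atLeastAtMost_int by (simp only: nat_int)
  qed
  ultimately have "card J < card F"
    unfolding K_def by linarith
  then obtain c where c: "\<exists>k\<in>F. c k \<noteq> 0"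
    "\<forall>j\<in>J. (\<Sum>k\<in>F. c k * gabor_system M N g k j) = 0"
    using underdetermined_system_nontrivial[of J F "\<lambda>j k. gabor_system M N g k j"]
    unfolding J_def F_def by auto
  have "gabor_system M N g k j = 0" if "k \<in> F" "j \<notin> J" for k j
  proof (rule ccontr)
    assume *: "gabor_system M N g k j \<noteq> 0"
    obtain n m where k: "k = (n, m)" "0 \<le> n" "n \<le> int K"
      using \<open>k \<in> F\<close> unfolding F_def by auto
    then have "\<bar>j - n * int N\<bar> \<le> int L"
      using * by (intro L) (auto simp: gabor_system_apply)
    moreover have "0 \<le> n * int N" "n * int N \<le> int K * int N"
      using k by (auto intro: mult_right_mono)
    ultimately show False
      using that(2) unfolding J_def by auto
  qed
  then have "(\<Sum>k\<in>F. c k * gabor_system M N g k j) = 0" for j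
    using c(2) by (cases "j \<in> J") auto
  with c(1) show ?thesis
    unfolding linearly_dependent_family_def
    by (intro exI[of _ F] exI[of _ c]) (auto simp: F_def gabor_index_def)
qed

lemma undersampled_gabor_not_frame:
  assumes "M < N" and g: "finite {j. g j \<noteq> 0}"
  shows "\<not> ell2_frame (gabor_index M) (gabor_system M N g)"
proof
  assume "ell2_frame (gabor_index M) (gabor_system M N g)"
  then obtain A where A: "A > 0"
    and lower: "\<And>h. h \<in> ell2 \<Longrightarrow> A * (ell2_norm h)\<^sup>2
      \<le> (\<Sum>\<^sub>\<infinity>k\<in>gabor_index M. (cmod (ell2_inner h (gabor_system M N g k)))\<^sup>2)"
    unfolding ell2_frame_def by blast
  obtain L :: nat where L: "\<And>j. g j \<noteq> 0 \<Longrightarrow> \<bar>j\<bar> \<le> int L"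
    using finite_support_bound[OF g] by blast
  \<comment> \<open>The window \<open>J\<close> has \<open>K * N\<close> points, at least
    \<open>K * M + K\<close>, while \<open>E\<close> has \<open>(K + 2 * L + 1) * M\<close>
    elements; so \<open>K\<close> has to exceed \<open>M * (2 * L + 1)\<close>.\<close>
  define K where "K = M * (2 * L + 1) + 1"
  \<comment> \<open>Contains every index whose atom can meet \<open>J\<close>: since
    \<open>N\<close> is at least 1, atoms with \<open>n < - L\<close> end before 0, and those with
    \<open>n > K + L\<close> start beyond \<open>K * N\<close>.\<close>
  define E where "E = {- int L..int (K + L)} \<times> {0..<M}"
  define J where "J = {0..<int (K * N)}"
  have "K * M + K \<le> K * N"
    using assms(1) by (metis Suc_leI mult_Suc_right mult_le_mono2 add.commute)
  moreover have "card E = (K + 2 * L + 1) * M"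
  proof -
    have "int (K + L) - - int L + 1 = int (K + 2 * L + 1)"
      by simp
    then show ?thesis
      unfolding E_def card_cartesian_product card_atLeastAtMost_int
      by (simp only: nat_int card_atLeastLessThan diff_zero)
  qed
  moreover have "card J = K * N"
    unfolding J_def card_atLeastLessThan_int diff_zero nat_int ..
  ultimately have "card E < card J"
    unfolding K_def by (simp add: algebra_simps)
  then obtain c where c: "\<exists>j\<in>J. c j \<noteq> 0"
    "\<forall>k\<in>E. (\<Sum>j\<in>J. c j * cnj (gabor_system M N g k j)) = 0"
    using underdetermined_system_nontrivial[of E J "\<lambda>k j. cnj (gabor_system M N g k j)"]
    unfolding J_def E_def by auto
  define h where "h j = (if j \<in> J then c j else 0)" for j
  have h: "h \<in> ell2"
    by (rule ell2_finite_support, rule finite_subset[of _ J]) (auto simp: h_def J_def)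
  have "ell2_inner h (gabor_system M N g k) = 0" if "k \<in> gabor_index M" for k
  proof -
    have "ell2_inner h (gabor_system M N g k) = (\<Sum>\<^sub>\<infinity>j\<in>J. c j * cnj (gabor_system M N g k j))"
      unfolding ell2_inner_def by (rule infsum_cong_neutral) (auto simp: h_def)
    also have "\<dots> = (\<Sum>j\<in>J. c j * cnj (gabor_system M N g k j))"
      by (rule infsum_finite) (simp add: J_def)
    also have "\<dots> = 0"
    proof (cases "k \<in> E")
      case False
      have "gabor_system M N g k j = 0" if j: "j \<in> J" for j
      proof (rule ccontr)
        assume *: "gabor_system M N g k j \<noteq> 0"
        obtain n m where k: "k = (n, m)" "m < M"
          using \<open>k \<in> gabor_index M\<close> unfolding gabor_index_def by auto
        with * have le: "\<bar>j - n * int N\<bar> \<le> int L"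
          by (intro L) (auto simp: gabor_system_apply)
        have N: "1 \<le> int N"
          using assms(1) by simp
        consider "n < - int L" | "n > int (K + L)"
          using False k unfolding E_def by force
        then show False
        proof cases
          case 1
          then have "n * int N \<le> n"
            using mult_left_mono_neg[OF N, of n] by linarith
          moreover have "0 \<le> j"
            using j unfolding J_def by simp
          ultimately show False
            using 1 le by linarith
        next
          case 2
          then have "(int K + int L + 1) * int N \<le> n * int N"
            by (intro mult_right_mono) auto
          moreover have "int L \<le> int L * int N"
            using mult_left_mono[OF N, of "int L"] by simp
          ultimately have "int K * int N + int L + 1 \<le> n * int N"
            using N by (simp add: distrib_right)
          then show False
            using le j unfolding J_def by auto
        qed
      qed
      then show ?thesis by simp
    qed (use c(2) in blast)
    finally show ?thesis .
  qed
  then have "A * (ell2_norm h)\<^sup>2 \<le> 0"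
    using lower[OF h] by (simp cong: infsum_cong)
  then have "ell2_norm h = 0"
    using A by (simp add: mult_le_0_iff)
  then have "h j = 0" for j
    using ell2_cmod_le[OF h, of j] by simp
  with c(1) show False
    unfolding h_def by metis
qed

theorem corollary2p4:
  fixes M N :: nat and g :: "int \<Rightarrow> complex"
  assumes "M \<ge> 1" and "N \<ge> 1"
    and "g \<in> ell2"
    and "finite {j. g j \<noteq> 0}"
    and "overcomplete_frame (gabor_index M) (gabor_system M N g)"
  shows "linearly_dependent_family (gabor_index M) (gabor_system M N g)"
proof -
  have "ell2_frame (gabor_index M) (gabor_system M N g)"
    and "\<not> ell2_basis (gabor_index M) (gabor_system M N g)"
    using assms(5) unfolding overcomplete_frame_def by simp_all
  then have "N < M"
    using undersampled_gabor_not_frame[OF _ assms(4)] critical_gabor_frame_basis[OF assms(1,4)]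
    by (metis linorder_neqE_nat)
  then show ?thesis
    using assms(4) by (rule oversampled_gabor_dependent)
qed

end
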